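(* For every $0<\epsilon<1$ there exist a constant $c=c(\epsilon)>0$ and an integer $n_0$ such that for all $n>n_0$ and all integers $1\le b\le (1-\epsilon)n/2$, Client has a strategy in the $(1:b)$ Client-Waiter game on the edges of the complete graph $K_n$ on $n$ vertices which guarantees that Client's graph contains a cycle of length at least $cn$.
   Context: In the $(1:b)$ Client-Waiter game played on $E(K_n)$, where $b\ge 1$ is an integer, in each turn Waiter offers Client a subset of at least one and at most $b+1$ unclaimed edges; Client claims exactly one of the offered edges, and the remaining offered edges are claimed by Waiter. The game ends when all edges have been claimed. Client's graph is the graph formed by the edges claimed by Client at the end of the game. "Linearly long cycle" means a cycle of length at least $cn$, for a constant $c>0$ depending only on $\epsilon$. *)

theory Defs
  imports Complex_Main
begin

section \<open>Client-Waiter games\<close>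

text \<open>A history lists the completed turns in order. A turn is a pair (F, e): Waiter offered
  the set F, Client claimed e, and Waiter claimed the remaining elements of F.\<close>

type_synonym 'e history = "('e set \<times> 'e) list"

text \<open>A strategy answers an offer, given the history of the preceding turns.\<close>

type_synonym 'e strategy = "'e history \<Rightarrow> 'e set \<Rightarrow> 'e"

definition claimed :: "'e history \<Rightarrow> 'e set" where
  "claimed h = (\<Union>(F, e)\<in>set h. F)"

definition client_claimed :: "'e history \<Rightarrow> 'e set" where
  "client_claimed h = snd ` set h"

definition client_strategy :: "'e strategy \<Rightarrow> bool" where
  "client_strategy \<sigma> \<longleftrightarrow> (\<forall>h F. F \<noteq> {} \<longrightarrow> \<sigma> h F \<in> F)"

text \<open>The histories that can arise in the (1:b) game on the board X when Client follows
  the strategy; Waiter's offers are arbitrary legal ones.\<close>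

inductive history_of :: "'e set \<Rightarrow> nat \<Rightarrow> 'e strategy \<Rightarrow> 'e history \<Rightarrow> bool"
  for X :: "'e set" and b :: nat and \<sigma> :: "'e strategy" where
  start: "history_of X b \<sigma> []"
| turn: "history_of X b \<sigma> (h @ [(F, \<sigma> h F)])"
    if "history_of X b \<sigma> h"
      and "F \<subseteq> X - claimed h" and "finite F" and "1 \<le> card F" and "card F \<le> b + 1"

definition client_can_force :: "'e set \<Rightarrow> nat \<Rightarrow> ('e set \<Rightarrow> bool) \<Rightarrow> bool" where
  "client_can_force X b P \<longleftrightarrow>
     (\<exists>\<sigma>. client_strategy \<sigma> \<and>
        (\<forall>h. history_of X b \<sigma> h \<longrightarrow> claimed h = X \<longrightarrow> P (client_claimed h)))"

section \<open>Graphs, given by their sets of two-element edges\<close>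

definition complete_graph_edges :: "nat \<Rightarrow> nat set set" where
  "complete_graph_edges n = {{u, v} |u v. u < n \<and> v < n \<and> u \<noteq> v}"

text \<open>The vertices of the cycle in cyclic order, without repetition of the first one at the
  end, so that the length of the list is the length of the cycle.\<close>

definition is_cycle :: "'v set set \<Rightarrow> 'v list \<Rightarrow> bool" where
  "is_cycle E vs \<longleftrightarrow>
     3 \<le> length vs \<and> distinct vs \<and>
     (\<forall>i<length vs. {vs ! i, vs ! (Suc i mod length vs)} \<in> E)"

end

theory Submission
  imports Defs
begin

text \<open>
  The idea is that Client's graph has more than $(1+\<delta>)n$ edges, and that Client can arrange for
  $(1+\<delta>)n$ of them to form a graph in which no vertex set of size at most $\<beta>n$ is dense. Such a
  graph contains a subgraph with good vertex expansion, and expansion forces a long cycle.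

  Client imitates a random player. Fix $p$ above $2/n$, by a constant factor, with $p(b+1) \<le> 1$. When offered
  $F$, the imaginary random Client keeps each edge of $F$ with probability $p$, at most one of them,
  and with the remaining probability $1 - p|F|$ he keeps none: he must still claim an edge, but he
  ignores it. Because of this option a Waiter who offers few edges at a time, and so forces
  Client's choice, gains nothing. Every edge is kept with probability $p$, and a given set $A$ of edges
  is kept entirely with probability at most $p^{|A|}$. The method of conditional expectations
  turns this into a deterministic strategy (\<open>client_can_force_expectation\<close>): for any family of
  bad sets, Client's kept edges, minus the number of bad sets among them, reach at least the
  expected value.

  The bad sets are the \<open>crowded\<close> ones: slightly more than $(1+1/d)s$ edges spanned by $s$ vertices, for
  $1 \<le> s \<le> \<beta>n$. A union bound gives expected number at most $1$ for each $s$, so at most $\<beta>n$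
  altogether. Deleting one edge from each bad set leaves a graph with at least $(1+2/d)n$ edges
  and without crowded sets (\<open>client_forces_locally_sparse\<close>).

  In that graph take a minimal nonempty vertex set $W$ that spans at least $(1+2/d)|W|$ edges. By minimality,
  every $U \<subseteq> W$ meets at least $(1+2/d)|U|$ of these edges; they all lie inside $U$ together
  with its neighbourhood, which for small $U$ spans few edges. So the neighbourhood has size at least
  $|U|/(d+1)$ (\<open>minimal_dense_expansion\<close>). Finally \<open>long_cycle_of_expansion\<close> finds a path
  $Q$ and a set of linear size, accessible from the end of $Q$, all of whose neighbours lie on $Q$. There are
  linearly many of these neighbours, so one of them is far from the end of $Q$ and closes a long cycle.
\<close>

section \<open>Invariants that Client can maintain\<close>

lemma claimed_Nil [simp]: "claimed [] = {}"
  and client_claimed_Nil [simp]: "client_claimed [] = {}"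
  and claimed_snoc [simp]: "claimed (h @ [(F, e)]) = claimed h \<union> F"
  and client_claimed_snoc [simp]: "client_claimed (h @ [(F, e)]) = insert e (client_claimed h)"
  by (auto simp: claimed_def client_claimed_def)

text \<open>A relation between the elements claimed by Client and those still unclaimed needs
  only that some answer to every offer preserves it; the choice of such an answer is a strategy. Any
  further information that Client wants to remember is hidden in the relation as an existential
  quantifier.\<close>

lemma client_can_force_invariant:
  fixes X :: "'e set" and I :: "'e set \<Rightarrow> 'e set \<Rightarrow> bool"
  assumes start: "I {} X"
    and step: "\<And>D U F. I D U \<Longrightarrow> U \<subseteq> X \<Longrightarrow> F \<subseteq> U \<Longrightarrow> F \<noteq> {} \<Longrightarrow> finite F \<Longrightarrow> card F \<le> b + 1
                 \<Longrightarrow> \<exists>e\<in>F. I (insert e D) (U - F)"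
    and final: "\<And>D. I D {} \<Longrightarrow> P D"
  shows "client_can_force X b P"
proof -
  define good where "good h F e \<longleftrightarrow> I (insert e (client_claimed h)) (X - claimed h - F)" for h F e
  define \<sigma> where "\<sigma> h F = (if \<exists>e\<in>F. good h F e then SOME e. e \<in> F \<and> good h F e else SOME e. e \<in> F)"
    for h F
  have good_\<sigma>: "\<sigma> h F \<in> F \<and> good h F (\<sigma> h F)" if "\<exists>e\<in>F. good h F e" for h F
    using someI_ex[of "\<lambda>e. e \<in> F \<and> good h F e"] that by (auto simp: \<sigma>_def)
  have strategy: "client_strategy \<sigma>"
    unfolding client_strategy_def
  proof (intro allI impI)
    fix h :: "'e history" and F :: "'e set"
    assume "F \<noteq> {}"
    then show "\<sigma> h F \<in> F"
      using good_\<sigma>[of F h] some_in_eq[of F] by (cases "\<exists>e\<in>F. good h F e") (auto simp: \<sigma>_def)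
  qed
  have invariant: "I (client_claimed h) (X - claimed h)" if "history_of X b \<sigma> h" for h
    using that
  proof induction
    case start
    show ?case using assms(1) by simp
  next
    case (turn h F)
    have "F \<noteq> {}" using turn.hyps by auto
    then have "\<exists>e\<in>F. good h F e"
      unfolding good_def using turn by (intro step) auto
    then have "good h F (\<sigma> h F)" using good_\<sigma> by blast
    then show ?case by (simp add: good_def Diff_Diff_Int set_diff_eq Int_def Un_def conj_assoc)
  qed
  show ?thesis
    unfolding client_can_force_def using strategy invariant final by (metis Diff_cancel)
qed

section \<open>Derandomising a random Client\<close>

text \<open>The probability bound for keeping all of \<open>A\<close> when \<open>C\<close> is kept already and \<open>U\<close> is still
  unclaimed: it is the probability if each element of \<open>U\<close> were kept independently.\<close>

definition containment_weight :: "real \<Rightarrow> 'e set \<Rightarrow> 'e set \<Rightarrow> 'e set \<Rightarrow> real" where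
  "containment_weight p C U A = (if A \<subseteq> C \<union> U then p ^ card (A - C) else 0)"

text \<open>The conditional expectation of the number of kept elements minus the number of bad sets
  that are kept entirely, under independence.\<close>

definition potential :: "real \<Rightarrow> 'e set set \<Rightarrow> 'e set \<Rightarrow> 'e set \<Rightarrow> real" where
  "potential p \<A> C U = real (card C) + p * real (card U) - (\<Sum>A\<in>\<A>. containment_weight p C U A)"

text \<open>Keeping at most one element of each offer can only help: a set that meets the offer in
  at most one element has the same chance as under independence, and a set that meets it in two or more
  elements can no longer be kept entirely.\<close>

lemma containment_weight_average:
  assumes "finite U" "finite A" "F \<subseteq> U" "C \<inter> U = {}" "0 \<le> p"
  shows "(\<Sum>e\<in>F. p * containment_weight p (insert e C) (U - F) A)
           + (1 - p * card F) * containment_weight p C (U - F) A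
         \<le> containment_weight p C U A"
proof (cases "A \<subseteq> C \<union> U")
  case False
  then have "\<not> A \<subseteq> insert e C \<union> (U - F)" if "e \<in> F" for e
    using that assms(3) by auto
  moreover have "\<not> A \<subseteq> C \<union> (U - F)" using False by auto
  ultimately show ?thesis by (simp add: containment_weight_def False)
next
  case sub: True
  have finF: "finite F" using assms finite_subset by blast
  consider "A \<inter> F = {}" | e where "A \<inter> F = {e}" | e e' where "e \<in> A \<inter> F" "e' \<in> A \<inter> F" "e \<noteq> e'"
    by blast
  then show ?thesis
  proof cases
    case 1
    have "A - insert e C = A - C" if "e \<in> F" for e using 1 that by auto
    then have "containment_weight p (insert e C) (U - F) A = containment_weight p C U A" if "e \<in> F" for e
      using 1 sub that by (auto simp: containment_weight_def)
    moreover have "containment_weight p C (U - F) A = containment_weight p C U A"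
      using 1 sub by (auto simp: containment_weight_def)
    ultimately show ?thesis by (simp add: algebra_simps)
  next
    case (2 e0)
    have e0: "e0 \<in> A - C" "e0 \<in> F" using 2 assms by auto
    have zero: "containment_weight p (insert e C) (U - F) A = 0" if "e \<in> F" "e \<noteq> e0" for e
      using that e0 by (auto simp: containment_weight_def)
    have "A - insert e0 C = (A - C) - {e0}" by auto
    then have "card (A - C) = Suc (card (A - insert e0 C))"
      using e0(1) assms(2) by (metis card_Suc_Diff1 finite_Diff)
    moreover have "A \<subseteq> insert e0 C \<union> (U - F)" using 2 sub by auto
    ultimately have one: "p * containment_weight p (insert e0 C) (U - F) A = containment_weight p C U A"
      using sub by (simp add: containment_weight_def)
    have "(\<Sum>e\<in>F. p * containment_weight p (insert e C) (U - F) A)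
        = (\<Sum>e\<in>F. if e = e0 then containment_weight p C U A else 0)"
      using zero one by (intro sum.cong) auto
    also have "\<dots> = containment_weight p C U A" using finF e0 by simp
    finally show ?thesis using e0 by (auto simp: containment_weight_def)
  next
    case (3 e e')
    have "e \<notin> C" "e' \<notin> C" using 3 assms by auto
    then have "\<not> A \<subseteq> insert x C \<union> (U - F)" for x using 3 by blast
    moreover have "\<not> A \<subseteq> C \<union> (U - F)" using 3 assms by auto
    ultimately show ?thesis using assms by (simp add: containment_weight_def)
  qed
qed

lemma potential_average:
  assumes "finite U" "finite C" "\<And>A. A \<in> \<A> \<Longrightarrow> finite A" "F \<subseteq> U" "C \<inter> U = {}" "0 \<le> p"
  shows "potential p \<A> C U
         \<le> (\<Sum>e\<in>F. p * potential p \<A> (insert e C) (U - F)) + (1 - p * card F) * potential p \<A> C (U - F)"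
proof -
  let ?w = "containment_weight p"
  let ?k = "real (card F)"
  let ?u = "real (card (U - F))"
  have finF: "finite F" using assms finite_subset by blast
  have cU: "real (card U) = ?u + ?k"
    using assms finF by (simp add: card_Diff_subset card_mono)
  have cC: "real (card (insert e C)) = card C + 1" if "e \<in> F" for e
    using that assms by (subst card_insert_disjoint) auto
  have "(\<Sum>e\<in>F. p * (\<Sum>A\<in>\<A>. ?w (insert e C) (U - F) A)) + (1 - p * ?k) * (\<Sum>A\<in>\<A>. ?w C (U - F) A)
     = (\<Sum>A\<in>\<A>. (\<Sum>e\<in>F. p * ?w (insert e C) (U - F) A) + (1 - p * ?k) * ?w C (U - F) A)"
    by (simp add: sum.distrib sum_distrib_left sum.swap[of _ \<A> F])
  also have "\<dots> \<le> (\<Sum>A\<in>\<A>. ?w C U A)"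
    using assms by (intro sum_mono containment_weight_average) auto
  finally have weights: "(\<Sum>e\<in>F. p * (\<Sum>A\<in>\<A>. ?w (insert e C) (U - F) A))
      + (1 - p * ?k) * (\<Sum>A\<in>\<A>. ?w C (U - F) A) \<le> (\<Sum>A\<in>\<A>. ?w C U A)" .
  have "(\<Sum>e\<in>F. p * potential p \<A> (insert e C) (U - F))
      = (\<Sum>e\<in>F. p * (card C + 1 + p * ?u) - p * (\<Sum>A\<in>\<A>. ?w (insert e C) (U - F) A))"
    by (intro sum.cong) (simp_all add: potential_def cC right_diff_distrib)
  also have "\<dots> = ?k * (p * (card C + 1 + p * ?u)) - (\<Sum>e\<in>F. p * (\<Sum>A\<in>\<A>. ?w (insert e C) (U - F) A))"
    by (simp add: sum_subtractf)
  finally show ?thesis using weights by (simp add: potential_def cU algebra_simps)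
qed

text \<open>The coefficients \<open>p\<close>, one for each offered element, and \<open>1 - p * card F\<close> are the probabilities
  of the random choices, so the best choice is at least as good as the average one.\<close>

lemma potential_step:
  assumes "finite U" "finite C" "\<And>A. A \<in> \<A> \<Longrightarrow> finite A" "F \<subseteq> U" "C \<inter> U = {}" "0 \<le> p"
    and "p * real (card F) \<le> 1"
  shows "potential p \<A> C U \<le> potential p \<A> C (U - F)
       \<or> (\<exists>e\<in>F. potential p \<A> C U \<le> potential p \<A> (insert e C) (U - F))"
proof (rule ccontr)
  assume contr: "\<not> ?thesis"
  let ?f = "potential p \<A> C U"
  have finF: "finite F" using assms finite_subset by blast
  have less: "(\<Sum>e\<in>F. p * potential p \<A> (insert e C) (U - F)) \<le> (\<Sum>e\<in>F. p * ?f)"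
    using contr assms by (intro sum_mono mult_left_mono) (auto simp: not_le intro: less_imp_le)
  have none: "(1 - p * card F) * potential p \<A> C (U - F) \<le> (1 - p * card F) * ?f"
    using contr assms by (intro mult_left_mono) auto
  have total: "(\<Sum>e\<in>F. p * ?f) + (1 - p * card F) * ?f = ?f" by (simp add: algebra_simps)
  have avg: "?f \<le> (\<Sum>e\<in>F. p * potential p \<A> (insert e C) (U - F))
      + (1 - p * card F) * potential p \<A> C (U - F)"
    using assms by (intro potential_average) auto
  show False
  proof (cases "p * card F = 1")
    case False
    then have "(1 - p * card F) * potential p \<A> C (U - F) < (1 - p * card F) * ?f"
      using contr assms by (intro mult_strict_left_mono) auto
    then show False using avg less total by linarith
  next
    case True
    then have "F \<noteq> {}" "p > 0" using assms by (auto simp: less_le)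
    then have "(\<Sum>e\<in>F. p * potential p \<A> (insert e C) (U - F)) < (\<Sum>e\<in>F. p * ?f)"
      using contr finF by (intro sum_strict_mono mult_strict_left_mono) auto
    then show False using avg none total by linarith
  qed
qed

text \<open>The set \<open>C\<close> collects the claimed elements that Client does not ignore. Stating the result
  for a subset of the claimed elements is what makes it true for Waiters who offer fewer than
  \<open>b + 1\<close> elements.\<close>

theorem client_can_force_expectation:
  fixes X :: "'e set"
  assumes "finite X" "\<And>A. A \<in> \<A> \<Longrightarrow> A \<subseteq> X" "0 \<le> p" "p * (real b + 1) \<le> 1"
  shows "client_can_force X b (\<lambda>D. \<exists>C\<subseteq>D. C \<subseteq> X \<and>
           p * card X - (\<Sum>A\<in>\<A>. p ^ card A) \<le> real (card C) - real (card {A\<in>\<A>. A \<subseteq> C}))"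
proof -
  define I where "I D U \<longleftrightarrow> (\<exists>C\<subseteq>D. C \<subseteq> X \<and> C \<inter> U = {} \<and> potential p \<A> {} X \<le> potential p \<A> C U)"
    for D U
  have fin: "finite A" if "A \<in> \<A>" for A using that assms finite_subset by blast
  have "finite \<A>" using assms by (meson finite_Pow_iff finite_subset Pow_iff subsetI)
  show ?thesis
  proof (rule client_can_force_invariant[where I = I])
    show "I {} X" unfolding I_def by auto
    show "\<exists>e\<in>F. I (insert e D) (U - F)"
      if "I D U" and U: "U \<subseteq> X" and F: "F \<subseteq> U" "F \<noteq> {}" "finite F" "card F \<le> b + 1" for D U F
    proof -
      obtain C where C: "C \<subseteq> D" "C \<subseteq> X" "C \<inter> U = {}" "potential p \<A> {} X \<le> potential p \<A> C U"
        using \<open>I D U\<close> unfolding I_def by auto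
      have "p * card F \<le> p * (real b + 1)" using F assms by (intro mult_left_mono) auto
      then have "p * card F \<le> 1" using assms by linarith
      then have "potential p \<A> C U \<le> potential p \<A> C (U - F)
         \<or> (\<exists>e\<in>F. potential p \<A> C U \<le> potential p \<A> (insert e C) (U - F))"
        using C U F assms fin finite_subset[of _ X] by (intro potential_step) metis+
      then show ?thesis
      proof
        assume le: "potential p \<A> C U \<le> potential p \<A> C (U - F)"
        obtain e where "e \<in> F" using F by auto
        moreover have "I (insert e D) (U - F)"
          unfolding I_def by (rule exI[of _ C]) (use C le in auto)
        ultimately show ?thesis by blast
      next
        assume "\<exists>e\<in>F. potential p \<A> C U \<le> potential p \<A> (insert e C) (U - F)"
        then obtain e where e: "e \<in> F" "potential p \<A> C U \<le> potential p \<A> (insert e C) (U - F)" by auto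
        have "I (insert e D) (U - F)"
          unfolding I_def by (rule exI[of _ "insert e C"]) (use C e F U in auto)
        then show ?thesis using e by blast
      qed
    qed
    fix D assume "I D {}"
    then obtain C where C: "C \<subseteq> D" "C \<subseteq> X" "potential p \<A> {} X \<le> potential p \<A> C {}"
      unfolding I_def by auto
    have "(\<Sum>A\<in>\<A>. containment_weight p C {} A) = (\<Sum>A\<in>\<A>. if A \<subseteq> C then 1 else 0)"
      by (intro sum.cong) (auto simp: containment_weight_def Diff_eq_empty_iff[THEN iffD2])
    also have "\<dots> = real (card {A\<in>\<A>. A \<subseteq> C})"
      using \<open>finite \<A>\<close> by (simp flip: sum.inter_filter)
    finally have "potential p \<A> C {} = real (card C) - real (card {A\<in>\<A>. A \<subseteq> C})"
      by (simp add: potential_def)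
    moreover have "(\<Sum>A\<in>\<A>. containment_weight p {} X A) = (\<Sum>A\<in>\<A>. p ^ card A)"
      using assms by (intro sum.cong) (auto simp: containment_weight_def)
    then have "potential p \<A> {} X = p * card X - (\<Sum>A\<in>\<A>. p ^ card A)"
      by (simp add: potential_def)
    ultimately have "p * card X - (\<Sum>A\<in>\<A>. p ^ card A) \<le> real (card C) - real (card {A\<in>\<A>. A \<subseteq> C})"
      using C(3) by linarith
    then show "\<exists>C\<subseteq>D. C \<subseteq> X \<and>
             p * card X - (\<Sum>A\<in>\<A>. p ^ card A) \<le> real (card C) - real (card {A\<in>\<A>. A \<subseteq> C})"
      using C(1,2) by blast
  qed
qed

lemma delete_one_from_each:
  assumes "finite C" "finite \<A>" "{} \<notin> \<A>"
  obtains C' where "C' \<subseteq> C" "\<And>A. A \<in> \<A> \<Longrightarrow> \<not> A \<subseteq> C'"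
    "real (card C) - real (card {A\<in>\<A>. A \<subseteq> C}) \<le> real (card C')"
proof -
  define \<B> where "\<B> = {A\<in>\<A>. A \<subseteq> C}"
  define pick where "pick A = (SOME e. e \<in> A)" for A :: "'a set"
  have pick: "pick A \<in> A" if "A \<in> \<A>" for A
    unfolding pick_def using that assms some_in_eq[of A] by auto
  show thesis
  proof (rule that[of "C - pick ` \<B>"])
    show "C - pick ` \<B> \<subseteq> C" by auto
    show "\<not> A \<subseteq> C - pick ` \<B>" if "A \<in> \<A>" for A
      using pick[OF that] that by (auto simp: \<B>_def)
    have "finite \<B>" using assms by (simp add: \<B>_def)
    then have "card C - card \<B> \<le> card (C - pick ` \<B>)"
      using diff_card_le_card_Diff[of "pick ` \<B>" C] card_image_le[of \<B> pick] by auto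
    then show "real (card C) - real (card {A\<in>\<A>. A \<subseteq> C}) \<le> real (card (C - pick ` \<B>))"
      unfolding \<B>_def by linarith
  qed
qed

section \<open>A long cycle from vertex expansion\<close>

definition neighbours :: "'v set set \<Rightarrow> 'v set \<Rightarrow> 'v set" where
  "neighbours E U = {z. z \<notin> U \<and> (\<exists>w\<in>U. {w, z} \<in> E)}"

definition is_path :: "'v set set \<Rightarrow> 'v list \<Rightarrow> bool" where
  "is_path E vs \<longleftrightarrow> distinct vs \<and> successively (\<lambda>x y. {x, y} \<in> E) vs"

text \<open>Paths grow at the head. The vertices that a path, possibly of length zero, connects with the head of
  \<open>P\<close> outside the rest of \<open>P\<close>: the connected component of that head after the rest of \<open>P\<close> has been
  removed.\<close>

definition extension_heads :: "'v set set \<Rightarrow> 'v list \<Rightarrow> 'v set" where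
  "extension_heads E P = {hd (q @ P) |q. is_path E (q @ P)}"

lemma is_path_appendD: "is_path E (q @ P) \<Longrightarrow> is_path E P"
  by (auto simp: is_path_def successively_append_iff)

lemma is_path_takeD: "is_path E P \<Longrightarrow> is_path E (take i P)"
  by (metis append_take_drop_id is_path_def distinct_take successively_append_iff)

lemma is_path_verts:
  assumes "is_path E P" "2 \<le> length P"
  shows "set P \<subseteq> \<Union>E"
proof
  fix x assume "x \<in> set P"
  then obtain i where i: "i < length P" "x = P ! i" by (auto simp: in_set_conv_nth)
  have succ: "{P ! j, P ! Suc j} \<in> E" if "Suc j < length P" for j
    using assms that by (auto simp: is_path_def successively_conv_nth)
  show "x \<in> \<Union>E"
  proof (cases "Suc i < length P")
    case True
    then show ?thesis using succ[of i] i by auto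
  next
    case False
    then have "Suc (i - 1) < length P" "Suc (i - 1) = i" using i assms by auto
    then show ?thesis using succ[of "i - 1"] i by auto
  qed
qed

lemma extension_heads_disjoint: "extension_heads E (x # P) \<inter> set P = {}"
proof -
  have "hd (q @ x # P) \<notin> set P" if "is_path E (q @ x # P)" for q
    using that by (cases q) (auto simp: is_path_def)
  then show ?thesis by (auto simp: extension_heads_def)
qed

text \<open>If a neighbour of a reachable vertex lies on the path leading there, cut the path
  short; otherwise prolong the path by it. In either case it is reachable, unless it is blocked by \<open>P\<close>.\<close>

lemma extension_heads_neighbours:
  "neighbours E (extension_heads E (x # P)) \<subseteq> set P"
proof
  fix z assume "z \<in> neighbours E (extension_heads E (x # P))"
  then obtain q where z: "z \<notin> extension_heads E (x # P)" and q: "is_path E (q @ x # P)"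
    and adj: "{hd (q @ x # P), z} \<in> E"
    by (auto simp: neighbours_def extension_heads_def)
  show "z \<in> set P"
  proof (rule ccontr)
    assume "z \<notin> set P"
    show False
    proof (cases "z \<in> set (q @ [x])")
      case True
      then obtain q1 q2 where "q @ [x] = q1 @ z # q2" by (meson split_list)
      then have eq: "q @ x # P = q1 @ (z # q2) @ P"
        by (metis append.assoc append_Cons append_Nil)
      then have path: "is_path E ((z # q2) @ P)" using q is_path_appendD by metis
      have "\<exists>r. (z # q2) @ P = r @ x # P"
        using \<open>q @ [x] = q1 @ z # q2\<close>
        by (cases q2 rule: rev_cases) (auto simp flip: append_assoc append_Cons)
      then obtain r where r: "(z # q2) @ P = r @ x # P" by blast
      have "hd (r @ x # P) = z" using r by (metis append_Cons list.sel(1))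
      moreover have "is_path E (r @ x # P)" using path unfolding r .
      ultimately have "z \<in> extension_heads E (x # P)" by (auto simp: extension_heads_def)
      then show False using z by simp
    next
      case False
      have "is_path E ((z # q) @ x # P)"
        using q adj False \<open>z \<notin> set P\<close>
        by (cases q) (auto simp: is_path_def insert_commute)
      then have "z \<in> extension_heads E (x # P)"
        unfolding extension_heads_def by (intro CollectI exI[of _ "z # q"]) simp
      then show False using z by simp
    qed
  qed
qed

lemma is_cycleI:
  assumes "is_path E vs" "3 \<le> length vs" "{last vs, hd vs} \<in> E"
  shows "is_cycle E vs"
  unfolding is_cycle_def
proof (intro conjI allI impI)
  fix i assume i: "i < length vs"
  show "{vs ! i, vs ! (Suc i mod length vs)} \<in> E"
  proof (cases "Suc i < length vs")
    case True
    then show ?thesis using assms by (auto simp: is_path_def successively_conv_nth)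
  next
    case False
    then have "Suc i = length vs" using i by auto
    moreover from this have "vs ! i = last vs" by (metis diff_Suc_1 last_conv_nth length_0_conv nat.distinct(1))
    ultimately show ?thesis using assms by (metis hd_conv_nth length_0_conv mod_self nat.distinct(1))
  qed
qed (use assms in \<open>auto simp: is_path_def\<close>)

text \<open>Adding sets one at a time, each of size at most \<open>k\<close>, cannot jump over the window from \<open>k\<close>
  to \<open>2 * k\<close>.\<close>

lemma union_of_intermediate_size:
  assumes "finite Y" "\<And>y. y \<in> Y \<Longrightarrow> finite (B y) \<and> card (B y) \<le> k" "k \<le> card (\<Union>y\<in>Y. B y)"
  obtains Z where "Z \<subseteq> Y" "k \<le> card (\<Union>y\<in>Z. B y)" "card (\<Union>y\<in>Z. B y) \<le> 2 * k"
proof -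
  have "\<exists>Z\<subseteq>Y. k \<le> card (\<Union>y\<in>Z. B y) \<and> card (\<Union>y\<in>Z. B y) \<le> 2 * k"
    using assms
  proof (induction Y rule: finite_induct)
    case empty
    then show ?case by auto
  next
    case (insert y Y)
    show ?case
    proof (cases "k \<le> card (\<Union>y\<in>Y. B y)")
      case True
      then obtain Z where "Z \<subseteq> Y" "k \<le> card (\<Union>y\<in>Z. B y) \<and> card (\<Union>y\<in>Z. B y) \<le> 2 * k"
        using insert by blast
      then show ?thesis by (intro exI[of _ Z]) auto
    next
      case False
      have "card (\<Union>z\<in>insert y Y. B z) \<le> card (B y) + card (\<Union>z\<in>Y. B z)"
        by (simp add: card_Un_le)
      moreover have "card (B y) \<le> k" using insert.prems by auto
      ultimately have "card (\<Union>z\<in>insert y Y. B z) \<le> 2 * k" using False by linarith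
      then show ?thesis using insert.prems by (intro exI[of _ "insert y Y"]) auto
    qed
  qed
  then show thesis using that by blast
qed

text \<open>Take a longest path \<open>Q\<close> for which more than \<open>k\<close> vertices are reachable from its head outside
  the rest of \<open>Q\<close>. Removing the head as well splits these vertices into pieces, each containing a
  vertex that prolongs \<open>Q\<close>; as \<open>Q\<close> is longest, each piece has at most \<open>k\<close> vertices. Some union \<open>W\<close> of pieces
  has between \<open>k\<close> and \<open>2 * k\<close> vertices, and all its neighbours lie on \<open>Q\<close>. At least one of these
  \<open>l\<close> or more neighbours has \<open>l - 1\<close> vertices of \<open>Q\<close> between itself and \<open>W\<close>, and the path through \<open>W\<close> from the head
  of \<open>Q\<close> to that neighbour closes the cycle. The condition on all nonempty sets of size at most \<open>2 * k\<close> makes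
  every component large, so that a single vertex is already a path of the kind from which \<open>Q\<close> is chosen.\<close>

theorem long_cycle_of_expansion:
  assumes "finite E" "\<And>e. e \<in> E \<Longrightarrow> finite e" "E \<noteq> {}" "{} \<notin> E"
    and nonempty: "\<And>U. U \<subseteq> \<Union>E \<Longrightarrow> U \<noteq> {} \<Longrightarrow> card U \<le> 2 * k \<Longrightarrow> neighbours E U \<noteq> {}"
    and expand: "\<And>U. U \<subseteq> \<Union>E \<Longrightarrow> k \<le> card U \<Longrightarrow> card U \<le> 2 * k \<Longrightarrow> l \<le> card (neighbours E U)"
    and "1 \<le> k" "2 \<le> l"
  obtains vs where "is_cycle E vs" "l + 1 \<le> length vs"
proof -
  let ?V = "\<Union>E"
  let ?H = "extension_heads E"
  have finV: "finite ?V" using assms by auto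
  define L where "L Q \<longleftrightarrow> is_path E Q \<and> Q \<noteq> [] \<and> set Q \<subseteq> ?V \<and> k < card (?H Q)" for Q
  have H_sub: "?H Q \<subseteq> ?V" if "Q \<noteq> []" "set Q \<subseteq> ?V" for Q
  proof
    fix r assume "r \<in> ?H Q"
    then obtain q where q: "is_path E (q @ Q)" "r = hd (q @ Q)" by (auto simp: extension_heads_def)
    show "r \<in> ?V"
    proof (cases q)
      case Nil
      then show ?thesis using q that by (cases Q) auto
    next
      case (Cons a q')
      then have "2 \<le> length (q @ Q)" using that by (cases Q) auto
      then have "set (q @ Q) \<subseteq> ?V" using is_path_verts q(1) by metis
      then show ?thesis using q that Cons by auto
    qed
  qed
  obtain e where "e \<in> E" using \<open>E \<noteq> {}\<close> by (meson ex_in_conv)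
  moreover from this have "e \<noteq> {}" using \<open>{} \<notin> E\<close> by metis
  ultimately obtain v where v: "v \<in> ?V" by (meson UnionI ex_in_conv)
  have v_in: "v \<in> ?H [v]"
    unfolding extension_heads_def by (rule CollectI, rule exI[of _ "[]"]) (auto simp: is_path_def)
  have "neighbours E (?H [v]) = {}" using extension_heads_neighbours[of E v "[]"] by auto
  then have "2 * k < card (?H [v])" using nonempty[of "?H [v]"] H_sub[of "[v]"] v v_in by force
  then have "L [v]" using v by (auto simp: L_def is_path_def)
  moreover have "length Q < Suc (card ?V)" if "L Q" for Q
    using that card_mono[OF finV] distinct_card unfolding L_def is_path_def
    by (metis le_imp_less_Suc)
  ultimately obtain Q where Q: "L Q" and longest: "\<And>Q'. L Q' \<Longrightarrow> length Q' \<le> length Q"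
    using ex_has_greatest_nat[of L "[v]" length] by (metis less_imp_le)
  have pathQ: "is_path E Q" "Q \<noteq> []" "set Q \<subseteq> ?V" "k < card (?H Q)" using Q by (auto simp: L_def)
  define Y where "Y = {y. is_path E (y # Q)}"
  have Y_V: "Y \<subseteq> ?V"
  proof
    fix y assume "y \<in> Y"
    then show "y \<in> ?V" using is_path_verts[of E "y # Q"] pathQ by (cases Q) (auto simp: Y_def)
  qed
  have H_Y: "?H (y # Q) \<subseteq> ?V" if "y \<in> Y" for y
  proof (rule H_sub)
    show "set (y # Q) \<subseteq> ?V" using that Y_V pathQ(3) by auto
  qed simp
  have small: "finite (?H (y # Q)) \<and> card (?H (y # Q)) \<le> k" if "y \<in> Y" for y
  proof
    show "finite (?H (y # Q))" using H_Y that finV finite_subset by blast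
    have "\<not> L (y # Q)" using longest[of "y # Q"] by auto
    then show "card (?H (y # Q)) \<le> k" using that Y_V pathQ(3) by (auto simp: L_def Y_def)
  qed
  \<comment> \<open>A path reaching into the component of the head of \<open>Q\<close> leaves that head through some \<open>y\<close>.\<close>
  have cover: "?H Q \<subseteq> insert (hd Q) (\<Union>y\<in>Y. ?H (y # Q))"
  proof
    fix r assume "r \<in> ?H Q"
    then obtain q where q: "is_path E (q @ Q)" "r = hd (q @ Q)" by (auto simp: extension_heads_def)
    show "r \<in> insert (hd Q) (\<Union>y\<in>Y. ?H (y # Q))"
    proof (cases q rule: rev_cases)
      case Nil
      then show ?thesis using q by auto
    next
      case (snoc q' y)
      then have "is_path E (q' @ y # Q)" "r = hd (q' @ y # Q)" using q by auto
      then have "y \<in> Y" "r \<in> ?H (y # Q)"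
        using is_path_appendD by (auto simp: Y_def extension_heads_def)
      then show ?thesis by auto
    qed
  qed
  have finU: "finite (\<Union>y\<in>Y. ?H (y # Q))" using H_Y finV by (meson UN_least finite_subset)
  have "card (?H Q) \<le> Suc (card (\<Union>y\<in>Y. ?H (y # Q)))"
    using card_mono[OF _ cover] finU
    by (metis card_insert_if finite_insert le_SucI)
  then have "k \<le> card (\<Union>y\<in>Y. ?H (y # Q))" using pathQ by linarith
  then obtain Z where Z: "Z \<subseteq> Y" "k \<le> card (\<Union>y\<in>Z. ?H (y # Q))" "card (\<Union>y\<in>Z. ?H (y # Q)) \<le> 2 * k"
    using union_of_intermediate_size[of Y "\<lambda>y. ?H (y # Q)" k] small Y_V finV finite_subset by metis
  define W where "W = (\<Union>y\<in>Z. ?H (y # Q))"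
  have "W \<subseteq> ?V" using Z H_Y by (auto simp: W_def)
  then have many: "l \<le> card (neighbours E W)" using expand[of W] Z by (simp add: W_def)
  have nbQ: "neighbours E W \<subseteq> set Q"
  proof
    fix z assume "z \<in> neighbours E W"
    then obtain y where "y \<in> Z" "z \<in> neighbours E (?H (y # Q))"
      by (auto simp: neighbours_def W_def)
    then show "z \<in> set Q" using extension_heads_neighbours by fastforce
  qed
  \<comment> \<open>Position \<open>0\<close> is the head of \<open>Q\<close>, so the largest position is the neighbour farthest from \<open>W\<close>.\<close>
  define J where "J = {i. i < length Q \<and> Q ! i \<in> neighbours E W}"
  have J: "finite J" "neighbours E W \<subseteq> (!) Q ` J"
  proof -
    show "neighbours E W \<subseteq> (!) Q ` J"
    proof
      fix z assume z: "z \<in> neighbours E W"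
      then obtain i where "i < length Q" "z = Q ! i" using nbQ by (metis in_set_conv_nth subsetD)
      then show "z \<in> (!) Q ` J" using z by (auto simp: J_def)
    qed
  qed (simp add: J_def)
  have "J \<noteq> {}" using J many assms by auto
  define i where "i = Max J"
  have i: "i \<in> J" "\<And>j. j \<in> J \<Longrightarrow> j \<le> i" using J \<open>J \<noteq> {}\<close> by (auto simp: i_def)
  have "l \<le> card J" using many J by (meson order_trans surj_card_le)
  also have "\<dots> \<le> card {..i}" using i by (intro card_mono) auto
  finally have l: "l \<le> Suc i" by simp
  have "Q ! i \<in> neighbours E W" "i < length Q" using i by (auto simp: J_def)
  then obtain y q where y: "y \<in> Z" and q: "is_path E (q @ y # Q)" "{hd (q @ y # Q), Q ! i} \<in> E"
    by (auto simp: neighbours_def W_def extension_heads_def)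
  define vs where "vs = q @ y # take (Suc i) Q"
  have "vs = take (length q + Suc (Suc i)) (q @ y # Q)" by (simp add: vs_def)
  then have path: "is_path E vs" using is_path_takeD q by metis
  have len: "length vs = length q + Suc (Suc i)" using \<open>i < length Q\<close> by (simp add: vs_def)
  have "last vs = Q ! i" using \<open>i < length Q\<close> by (simp add: vs_def take_Suc_conv_app_nth)
  moreover have "hd vs = hd (q @ y # Q)" by (cases q) (auto simp: vs_def)
  ultimately have "{last vs, hd vs} \<in> E" using q by (simp add: insert_commute)
  then have "is_cycle E vs" using path len l assms by (intro is_cycleI) auto
  then show thesis using that len l by auto
qed

section \<open>Locally sparse graphs with many edges\<close>

definition edges_in :: "'v set set \<Rightarrow> 'v set \<Rightarrow> 'v set set" where
  "edges_in E W = {e\<in>E. e \<subseteq> W}"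

lemma minimal_dense_subset:
  assumes "V \<noteq> {}" "finite V" "a * card V \<le> d * card (edges_in E V)"
  obtains W where "W \<subseteq> V" "W \<noteq> {}" "a * card W \<le> d * card (edges_in E W)"
    "\<And>U. U \<subset> W \<Longrightarrow> U \<noteq> {} \<Longrightarrow> d * card (edges_in E U) < a * card U"
proof -
  define P where "P W \<longleftrightarrow> W \<subseteq> V \<and> W \<noteq> {} \<and> a * card W \<le> d * card (edges_in E W)" for W
  have "P V" using assms by (simp add: P_def)
  then obtain W where W: "P W" "\<And>U. P U \<Longrightarrow> card W \<le> card U"
    using ex_has_least_nat[of P V card] by blast
  show thesis
  proof (rule that[of W])
    fix U assume U: "U \<subset> W" "U \<noteq> {}"
    have "finite W" using W assms finite_subset by (auto simp: P_def)
    then have "card U < card W" using U psubset_card_mono by blast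
    then have "\<not> P U" using W(2) by (meson not_le)
    then show "d * card (edges_in E U) < a * card U" using U W by (auto simp: P_def)
  qed (use W in \<open>auto simp: P_def\<close>)
qed

text \<open>Removing \<open>U\<close> from \<open>W\<close> must destroy at least \<open>(d + 2) / d * card U\<close> edges, by minimality. All destroyed
  edges lie in \<open>U \<union> N\<close>, which spans at most \<open>(d + 1) / d * card (U \<union> N)\<close> edges; comparing the two bounds
  leaves room only if \<open>N\<close> is large.\<close>

lemma minimal_dense_expansion:
  assumes edges: "finite E" "\<And>e. e \<in> E \<Longrightarrow> card e = 2"
    and "finite W" and dense: "(d + 2) * card W \<le> d * card (edges_in E W)"
    and minimal: "\<And>U. U \<subset> W \<Longrightarrow> U \<noteq> {} \<Longrightarrow> d * card (edges_in E U) < (d + 2) * card U"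
    and U: "U \<subseteq> W" "U \<noteq> {}"
  defines "N \<equiv> neighbours (edges_in E W) U"
  assumes sparse: "d * card (edges_in E (U \<union> N)) \<le> (d + 1) * card (U \<union> N)"
  shows "card U \<le> (d + 1) * card N"
proof -
  have "edges_in E W \<subseteq> edges_in E (W - U) \<union> edges_in E (U \<union> N)"
  proof
    fix e assume e: "e \<in> edges_in E W"
    then have eE: "e \<in> E" "e \<subseteq> W" by (auto simp: edges_in_def)
    show "e \<in> edges_in E (W - U) \<union> edges_in E (U \<union> N)"
    proof (cases "e \<inter> U = {}")
      case True
      then show ?thesis using eE by (auto simp: edges_in_def)
    next
      case False
      then obtain u where u: "u \<in> e" "u \<in> U" by auto
      then obtain v where v: "e = {u, v}" using edges(2)[OF eE(1)] by (auto simp: card_2_iff)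
      then have "v \<in> U \<union> N" using u e by (auto simp: N_def neighbours_def)
      then show ?thesis using u v eE by (auto simp: edges_in_def)
    qed
  qed
  moreover have "finite (edges_in E S)" for S using edges by (simp add: edges_in_def)
  ultimately have "card (edges_in E W) \<le> card (edges_in E (W - U)) + card (edges_in E (U \<union> N))"
    by (meson card_Un_le card_mono finite_UnI order_trans)
  then have "d * card (edges_in E W) \<le> d * card (edges_in E (W - U)) + d * card (edges_in E (U \<union> N))"
    by (metis distrib_left mult_le_mono2)
  moreover have "d * card (edges_in E (W - U)) \<le> (d + 2) * card (W - U)"
  proof (cases "W - U = {}")
    case True
    have "{} \<notin> E" using edges(2)[of "{}"] by auto
    then have "edges_in E (W - U) = {}" unfolding True by (auto simp: edges_in_def)
    then show ?thesis by simp
  next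
    case False
    then show ?thesis using minimal[of "W - U"] U by (intro less_imp_le) auto
  qed
  moreover have "card W = card (W - U) + card U"
    using U \<open>finite W\<close> by (metis card_Diff_subset card_mono finite_subset le_add_diff_inverse2)
  moreover have "(d + 1) * card (U \<union> N) \<le> (d + 1) * (card U + card N)"
    by (intro mult_le_mono2 card_Un_le)
  ultimately show ?thesis using dense sparse by (simp add: algebra_simps)
qed

text \<open>The sparsity bound is applied to sets together with their neighbourhoods. With
  \<open>k = B div 4\<close>, a set of at most \<open>2 * k\<close> vertices whose closed neighbourhood exceeds \<open>B\<close> has at least
  \<open>2 * k\<close> neighbours anyway, so the expansion holds for all sets in question.\<close>

theorem long_cycle_of_locally_sparse:
  assumes V: "finite V" "V \<noteq> {}"
    and E: "\<And>e. e \<in> E \<Longrightarrow> e \<subseteq> V \<and> card e = 2"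
    and dense: "(d + 2) * card V \<le> d * card E"
    and sparse: "\<And>S. S \<subseteq> V \<Longrightarrow> S \<noteq> {} \<Longrightarrow> card S \<le> B
                   \<Longrightarrow> d * card (edges_in E S) \<le> (d + 1) * card S"
    and B: "2 * (d + 1) \<le> B div 4"
  obtains vs where "is_cycle E vs" "B div 4 < (d + 1) * length vs"
proof -
  have "E \<subseteq> Pow V" using E by auto
  then have finE: "finite E" using V finite_subset by blast
  have "edges_in E V = E" using E by (auto simp: edges_in_def)
  then obtain W where W: "W \<subseteq> V" "W \<noteq> {}" "(d + 2) * card W \<le> d * card (edges_in E W)"
    "\<And>U. U \<subset> W \<Longrightarrow> U \<noteq> {} \<Longrightarrow> d * card (edges_in E U) < (d + 2) * card U"
    using minimal_dense_subset[of V "d + 2" d E] V dense by auto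
  have finW: "finite W" using W V finite_subset by blast
  define G where "G = edges_in E W"
  define k where "k = B div 4"
  have VG: "\<Union>G \<subseteq> W" by (auto simp: G_def edges_in_def)
  have NG: "neighbours G U \<subseteq> W" for U using VG by (auto simp: neighbours_def)
  have expand: "card U \<le> (d + 1) * card (neighbours G U) \<or> 2 * k \<le> card (neighbours G U)"
    if "U \<subseteq> \<Union>G" "U \<noteq> {}" "card U \<le> 2 * k" for U
  proof (cases "card (U \<union> neighbours G U) \<le> B")
    case True
    have "U \<union> neighbours G U \<subseteq> V" using that VG NG W by blast
    then have "d * card (edges_in E (U \<union> neighbours G U)) \<le> (d + 1) * card (U \<union> neighbours G U)"
      using sparse True that by auto
    then have "card U \<le> (d + 1) * card (neighbours G U)"
      unfolding G_def
      using that VG E by (intro minimal_dense_expansion[OF finE _ finW W(3,4)]) (auto simp: G_def)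
    then show ?thesis ..
  next
    case False
    then have "B < card U + card (neighbours G U)" using card_Un_le le_less_trans not_le by metis
    then have "2 * k \<le> card (neighbours G U)" using that(3) unfolding k_def by linarith
    then show ?thesis ..
  qed
  have "card W > 0" using W finW by (simp add: card_gt_0_iff)
  then have "0 < (d + 2) * card W" by simp
  then have "card G \<noteq> 0" using W(3) unfolding G_def by (metis leD mult_0_right)
  then have "G \<noteq> {}" by auto
  have k: "2 * (d + 1) \<le> k" using B by (simp add: k_def)
  have two: "2 \<le> k div (d + 1)" using k by (simp add: less_eq_div_iff_mult_less_eq)
  obtain vs where vs: "is_cycle G vs" "k div (d + 1) + 1 \<le> length vs"
  proof (rule long_cycle_of_expansion[of G k "k div (d + 1)"])
    show "finite G" "G \<noteq> {}" using finE \<open>G \<noteq> {}\<close> by (auto simp: G_def edges_in_def)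
    show "finite e" if "e \<in> G" for e
      using that finW by (auto simp: G_def edges_in_def intro: finite_subset)
    show "{} \<notin> G" using E by (force simp: G_def edges_in_def)
    show "neighbours G U \<noteq> {}" if "U \<subseteq> \<Union>G" "U \<noteq> {}" "card U \<le> 2 * k" for U
    proof
      assume "neighbours G U = {}"
      moreover have "card U > 0"
        using that VG finW by (metis card_gt_0_iff finite_subset)
      ultimately show False using expand[OF that] k by simp
    qed
    show "k div (d + 1) \<le> card (neighbours G U)" if "U \<subseteq> \<Union>G" "k \<le> card U" "card U \<le> 2 * k" for U
    proof -
      have "U \<noteq> {}" using that k by auto
      then have "k \<le> (d + 1) * card (neighbours G U) \<or> k \<le> card (neighbours G U)"
        using expand[of U] that by auto
      then show ?thesis
      proof
        assume "k \<le> (d + 1) * card (neighbours G U)"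
        then have "k div (d + 1) \<le> (d + 1) * card (neighbours G U) div (d + 1)" by (rule div_le_mono)
        then show ?thesis by (metis nonzero_mult_div_cancel_left add_is_0 one_neq_zero)
      qed (meson div_le_dividend order_trans)
    qed
    show "1 \<le> k" "2 \<le> k div (d + 1)" using k two by auto
  qed
  have "k < (d + 1) * (k div (d + 1) + 1)"
    using dividend_less_times_div[of "d + 1" k] by simp
  also have "\<dots> \<le> (d + 1) * length vs" using vs(2) by (rule mult_le_mono2)
  finally have "k < (d + 1) * length vs" .
  moreover have "is_cycle E vs" using vs(1) by (auto simp: is_cycle_def G_def edges_in_def)
  ultimately show thesis using that by (simp add: k_def)
qed

section \<open>Crowded edge sets are rare\<close>

definition pairs :: "'v set \<Rightarrow> 'v set set" where
  "pairs W = {e. e \<subseteq> W \<and> card e = 2}"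

text \<open>The least integer above \<open>(1 + 1 / d) * s\<close>. The strict excess over \<open>s\<close> makes crowded sets rare.\<close>

definition crowded_size :: "nat \<Rightarrow> nat \<Rightarrow> nat" where
  "crowded_size d s = s + Suc (s div d)"

definition crowded :: "nat \<Rightarrow> nat \<Rightarrow> 'v set \<Rightarrow> 'v set set set" where
  "crowded d B V = {A. \<exists>W\<subseteq>V. W \<noteq> {} \<and> card W \<le> B \<and> A \<subseteq> pairs W \<and> card A = crowded_size d (card W)}"

lemma finite_pairs: "finite W \<Longrightarrow> finite (pairs W)"
  by (simp add: pairs_def)

lemma card_pairs: "finite W \<Longrightarrow> card (pairs W) = card W choose 2"
  by (simp add: pairs_def n_subsets)

lemma card_crowded_of_size:
  assumes "finite V"
  shows "card {A. \<exists>W. W \<subseteq> V \<and> card W = s \<and> A \<subseteq> pairs W \<and> card A = m}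
         \<le> (card V choose s) * ((s choose 2) choose m)"
proof -
  let ?\<W> = "{W. W \<subseteq> V \<and> card W = s}"
  have "{A. \<exists>W. W \<subseteq> V \<and> card W = s \<and> A \<subseteq> pairs W \<and> card A = m}
      = (\<Union>W\<in>?\<W>. {A. A \<subseteq> pairs W \<and> card A = m})" by auto
  also have "card \<dots> \<le> (\<Sum>W\<in>?\<W>. card {A. A \<subseteq> pairs W \<and> card A = m})"
    using assms by (intro card_UN_le) auto
  also have "\<dots> = (\<Sum>W\<in>?\<W>. (s choose 2) choose m)"
  proof (rule sum.cong)
    fix W assume "W \<in> ?\<W>"
    then have "finite W" "card W = s" using assms finite_subset by auto
    then show "card {A. A \<subseteq> pairs W \<and> card A = m} = (s choose 2) choose m"
      by (simp add: n_subsets finite_pairs card_pairs)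
  qed simp
  also have "\<dots> = (card V choose s) * ((s choose 2) choose m)" using assms by (simp add: n_subsets)
  finally show ?thesis .
qed

text \<open>The union bound over the spanning vertex sets, sorted by size; as \<open>crowded_size\<close> is strictly monotone,
  the size of a crowded set determines the number of vertices it is charged to.\<close>

lemma sum_crowded_le:
  fixes p :: real
  assumes "finite V" "0 \<le> p"
  shows "(\<Sum>A\<in>crowded d B V. p ^ card A)
    \<le> (\<Sum>s\<in>{1..B}. real (card V choose s) * real ((s choose 2) choose crowded_size d s) * p ^ crowded_size d s)"
proof -
  let ?m = "crowded_size d"
  define \<C> where "\<C> s = {A. \<exists>W. W \<subseteq> V \<and> card W = s \<and> A \<subseteq> pairs W \<and> card A = ?m s}" for s
  have "\<C> s \<subseteq> Pow (pairs V)" for s by (auto simp: \<C>_def pairs_def)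
  then have fin: "finite (\<C> s)" for s using assms by (meson finite_Pow_iff finite_pairs finite_subset)
  have eq: "crowded d B V = (\<Union>s\<in>{1..B}. \<C> s)"
  proof (intro subset_antisym subsetI)
    fix A assume "A \<in> crowded d B V"
    then obtain W where W: "W \<subseteq> V" "W \<noteq> {}" "card W \<le> B" "A \<subseteq> pairs W" "card A = ?m (card W)"
      by (auto simp: crowded_def)
    moreover from this have "card W \<ge> 1" using assms by (metis One_nat_def Suc_leI card_gt_0_iff finite_subset)
    ultimately have "card W \<in> {1..B}" "A \<in> \<C> (card W)" unfolding \<C>_def by auto
    then show "A \<in> (\<Union>s\<in>{1..B}. \<C> s)" by blast
  next
    fix A assume "A \<in> (\<Union>s\<in>{1..B}. \<C> s)"
    then obtain W where "1 \<le> card W" "card W \<le> B" "W \<subseteq> V" "A \<subseteq> pairs W" "card A = ?m (card W)"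
      by (auto simp: \<C>_def)
    then show "A \<in> crowded d B V" unfolding crowded_def by (intro CollectI exI[of _ W]) auto
  qed
  have mono: "strict_mono ?m"
    by (simp add: strict_mono_Suc_iff crowded_size_def less_Suc_eq_le div_le_mono)
  have disj: "\<C> s \<inter> \<C> t = {}" if "s \<noteq> t" for s t
    using that strict_mono_eq[OF mono] by (auto simp: \<C>_def)
  have "(\<Sum>A\<in>crowded d B V. p ^ card A) = (\<Sum>s\<in>{1..B}. \<Sum>A\<in>\<C> s. p ^ card A)"
    unfolding eq using fin disj by (intro sum.UNION_disjoint) auto
  also have "\<dots> = (\<Sum>s\<in>{1..B}. \<Sum>A\<in>\<C> s. p ^ ?m s)"
    by (intro sum.cong) (auto simp: \<C>_def)
  also have "\<dots> = (\<Sum>s\<in>{1..B}. real (card (\<C> s)) * p ^ ?m s)" by simp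
  also have "\<dots> \<le> (\<Sum>s\<in>{1..B}. real ((card V choose s) * ((s choose 2) choose ?m s)) * p ^ ?m s)"
    unfolding \<C>_def using assms card_crowded_of_size[OF assms(1)]
    by (intro sum_mono mult_right_mono) (simp_all only: of_nat_le_iff zero_le_power)
  finally show ?thesis by simp
qed

text \<open>The single term \<open>k ^ k / fact k\<close> of the exponential series is at most \<open>exp k\<close>.\<close>

lemma binomial_le_exp:
  assumes "1 \<le> k"
  shows "real (n choose k) \<le> (exp 1 * n / k) ^ k"
proof -
  have "(\<Sum>i\<in>{k}. real k ^ i /\<^sub>R fact i) \<le> exp (real k)"
    using summable_exp_generic[of "real k"] unfolding exp_def by (intro sum_le_suminf) auto
  then have "real k ^ k \<le> exp (real k) * fact k" by (simp add: field_simps)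
  then have "real k ^ k \<le> exp 1 ^ k * fact k" by (simp add: exp_of_nat_mult[symmetric])
  then have "real (n choose k) * real k ^ k \<le> real (n choose k) * (exp 1 ^ k * fact k)"
    by (rule mult_left_mono) simp
  also have "\<dots> = exp 1 ^ k * real ((n choose k) * fact k)" by simp
  also have "\<dots> \<le> exp 1 ^ k * real (n ^ k)"
    by (intro mult_left_mono) (simp_all only: of_nat_le_iff binomial_fact_pow, simp)
  finally have "real (n choose k) * real k ^ k \<le> (exp 1 * n) ^ k" by (simp add: power_mult_distrib)
  then show ?thesis using assms by (simp add: power_divide field_simps)
qed

text \<open>Let \<open>m = s + j\<close> be the crowded size. There are at most $(en/s)^s$ vertex sets and $(es)^m$ edge sets
  in each, so the term is at most $e^s (4e)^m (s/n)^j$: of the factors $n$ and $s$, only the excess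
  $j$ survives. Since $s \<le> dj$, the constants amount to at most $(4e)^{(2d+1)j}$, and $s/n$ is small enough
  to cancel them.\<close>

lemma crowded_term_le_1:
  fixes p :: real
  assumes "1 \<le> s" "1 \<le> d" "0 \<le> p" "p \<le> 4 / n" "(4 * exp 1) ^ (2 * d + 1) * real s \<le> real n"
  shows "real (n choose s) * real ((s choose 2) choose crowded_size d s) * p ^ crowded_size d s \<le> 1"
proof -
  define K :: real where "K = 4 * exp 1"
  define j where "j = Suc (s div d)"
  define m where "m = s + j"
  have K: "1 \<le> K" "exp 1 \<le> K" using exp_ge_add_one_self[of 1] by (auto simp: K_def)
  have "0 < K ^ (2 * d + 1) * real s" using K assms by simp
  then have n: "0 < real n" using assms unfolding K_def by linarith
  have "s < d * j" using dividend_less_times_div[of d s] assms by (simp add: j_def)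
  then have exponent: "s + m \<le> (2 * d + 1) * j" by (simp add: m_def algebra_simps)
  have b1: "real (n choose s) \<le> (exp 1 * n / s) ^ s" using binomial_le_exp assms by blast
  have "real ((s choose 2) choose m) \<le> (exp 1 * (s choose 2) / m) ^ m"
    using binomial_le_exp[of m] assms by (simp add: m_def)
  also have "\<dots> \<le> (exp 1 * s) ^ m"
  proof (intro power_mono)
    have "s choose 2 \<le> s * s" by (simp add: choose_two) (meson div_le_dividend diff_le_self mult_le_mono2 order_trans)
    also have "\<dots> \<le> s * m" by (simp add: m_def)
    finally have "real (s choose 2) \<le> real s * real m" by (metis of_nat_le_iff of_nat_mult)
    then have "real (s choose 2) / real m \<le> real s"
      using assms by (simp add: pos_divide_le_eq m_def)
    then show "exp 1 * real (s choose 2) / real m \<le> exp 1 * real s"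
      using mult_left_mono[of "real (s choose 2) / real m" "real s" "exp 1"] by simp
  qed simp
  finally have b2: "real ((s choose 2) choose m) \<le> (exp 1 * s) ^ m" .
  have b3: "p ^ m \<le> (4 / n) ^ m" using assms by (intro power_mono) auto
  have "real (n choose s) * real ((s choose 2) choose m) * p ^ m
     \<le> (exp 1 * n / s) ^ s * (exp 1 * s) ^ m * (4 / n) ^ m"
    using b1 b2 b3 assms by (intro mult_mono) auto
  also have "\<dots> = exp 1 ^ s * K ^ m * (s / n) ^ j"
    using assms n by (simp add: m_def K_def power_add power_mult_distrib power_divide field_simps)
  also have "\<dots> \<le> K ^ s * K ^ m * (s / n) ^ j"
    using K by (intro mult_right_mono power_mono) auto
  also have "\<dots> = K ^ (s + m) * (s / n) ^ j" by (simp add: power_add)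
  also have "\<dots> \<le> K ^ ((2 * d + 1) * j) * (s / n) ^ j"
    using K exponent by (intro mult_right_mono power_increasing) auto
  also have "\<dots> = (K ^ (2 * d + 1) * (s / n)) ^ j" by (simp only: power_mult power_mult_distrib)
  also have "\<dots> \<le> 1"
    using assms n K by (intro power_le_one) (auto simp: K_def field_simps)
  finally show ?thesis by (simp add: crowded_size_def m_def j_def)
qed

lemma sparse_of_no_crowded:
  assumes "finite V" "E \<subseteq> pairs V" "\<And>A. A \<in> crowded d B V \<Longrightarrow> \<not> A \<subseteq> E"
    and "W \<subseteq> V" "W \<noteq> {}" "card W \<le> B"
  shows "d * card (edges_in E W) \<le> (d + 1) * card W"
proof -
  have "card (edges_in E W) < crowded_size d (card W)"
  proof (rule ccontr)
    assume "\<not> ?thesis"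
    then obtain A where A: "A \<subseteq> edges_in E W" "card A = crowded_size d (card W)"
      by (meson not_less obtain_subset_with_card_n)
    have "edges_in E W \<subseteq> pairs W" using assms by (auto simp: edges_in_def pairs_def)
    then have "A \<in> crowded d B V" using A assms unfolding crowded_def by blast
    then show False using assms(3) A by (auto simp: edges_in_def)
  qed
  then have "card (edges_in E W) \<le> card W + card W div d" by (simp add: crowded_size_def)
  then have "d * card (edges_in E W) \<le> d * card W + d * (card W div d)"
    by (metis distrib_left mult_le_mono2)
  also have "\<dots> \<le> d * card W + card W" by simp
  finally show ?thesis by simp
qed

section \<open>The Client-Waiter game\<close>

lemma client_can_force_mono:
  assumes "client_can_force X b P" "\<And>D. P D \<Longrightarrow> Q D"
  shows "client_can_force X b Q"
  using assms unfolding client_can_force_def by blast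

lemma complete_graph_edges_eq_pairs: "complete_graph_edges n = pairs {..<n}"
  by (fastforce simp: complete_graph_edges_def pairs_def card_2_iff)

text \<open>The strategy for the expectation, followed by the deletion of one edge from each crowded set.
  The number \<open>B\<close> subtracted is the bound on the expected number of crowded sets, one for each size.\<close>

theorem client_forces_locally_sparse:
  fixes p :: real
  assumes "1 \<le> d" "0 \<le> p" "p \<le> 4 / n" "p * (real b + 1) \<le> 1"
    and B: "(4 * exp 1) ^ (2 * d + 1) * real B \<le> real n"
  shows "client_can_force (complete_graph_edges n) b (\<lambda>D. \<exists>E\<subseteq>D. E \<subseteq> pairs {..<n} \<and>
           p * (n choose 2) - B \<le> real (card E) \<and> (\<forall>A\<in>crowded d B {..<n}. \<not> A \<subseteq> E))"
proof -
  let ?\<A> = "crowded d B {..<n}"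
  have sub: "A \<subseteq> pairs {..<n}" if "A \<in> ?\<A>" for A
    using that by (fastforce simp: crowded_def pairs_def)
  have fin: "finite ?\<A>"
    using sub by (meson PowI finite_Pow_iff finite_lessThan finite_pairs finite_subset subsetI)
  have "{} \<notin> ?\<A>" by (auto simp: crowded_def crowded_size_def)
  have "(\<Sum>A\<in>?\<A>. p ^ card A) \<le> (\<Sum>s\<in>{1..B}. real (card {..<n} choose s)
          * real ((s choose 2) choose crowded_size d s) * p ^ crowded_size d s)"
    using assms by (intro sum_crowded_le) auto
  also have "\<dots> \<le> (\<Sum>s\<in>{1..B}. 1)"
  proof (rule sum_mono)
    fix s assume s: "s \<in> {1..B}"
    then have "(4 * exp 1) ^ (2 * d + 1) * real s \<le> (4 * exp 1 :: real) ^ (2 * d + 1) * real B"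
      by (intro mult_left_mono) auto
    then have "(4 * exp 1) ^ (2 * d + 1) * real s \<le> real n" using B by linarith
    from crowded_term_le_1[OF _ assms(1-3) this]
    show "real (card {..<n} choose s) * real ((s choose 2) choose crowded_size d s)
        * p ^ crowded_size d s \<le> 1"
      using s by simp
  qed
  finally have sum: "(\<Sum>A\<in>?\<A>. p ^ card A) \<le> real B" by simp
  have "client_can_force (pairs {..<n}) b (\<lambda>D. \<exists>C\<subseteq>D. C \<subseteq> pairs {..<n} \<and>
     p * card (pairs {..<n}) - (\<Sum>A\<in>?\<A>. p ^ card A) \<le> real (card C) - real (card {A\<in>?\<A>. A \<subseteq> C}))"
    using assms sub by (intro client_can_force_expectation finite_pairs) auto
  then show ?thesis
    unfolding complete_graph_edges_eq_pairs
  proof (rule client_can_force_mono)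
    fix D assume "\<exists>C\<subseteq>D. C \<subseteq> pairs {..<n} \<and>
     p * card (pairs {..<n}) - (\<Sum>A\<in>?\<A>. p ^ card A) \<le> real (card C) - real (card {A\<in>?\<A>. A \<subseteq> C})"
    then obtain C where C: "C \<subseteq> D" "C \<subseteq> pairs {..<n}"
      "p * card (pairs {..<n}) - (\<Sum>A\<in>?\<A>. p ^ card A) \<le> real (card C) - real (card {A\<in>?\<A>. A \<subseteq> C})"
      by blast
    have "finite C" using C(2) by (meson finite_lessThan finite_pairs finite_subset)
    then obtain E where E: "E \<subseteq> C" "\<And>A. A \<in> ?\<A> \<Longrightarrow> \<not> A \<subseteq> E"
      "real (card C) - real (card {A\<in>?\<A>. A \<subseteq> C}) \<le> real (card E)"
      using delete_one_from_each[of C ?\<A>] fin \<open>{} \<notin> ?\<A>\<close> by blast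
    have "p * (n choose 2) - B \<le> real (card E)"
      using C(3) E(3) sum by (simp add: card_pairs)
    then show "\<exists>E\<subseteq>D. E \<subseteq> pairs {..<n} \<and> p * (n choose 2) - B \<le> real (card E)
        \<and> (\<forall>A\<in>?\<A>. \<not> A \<subseteq> E)"
      using C(1,2) E(1,2) by (intro exI[of _ E]) auto
  qed
qed

text \<open>With this \<open>p\<close> the expected number of edges is about \<open>n / (1 - \<epsilon> / 2)\<close>, hence at least
  \<open>(1 + 3 / d) * n\<close>: of the surplus \<open>3 * n / d\<close>, one third pays for the deleted edges and two thirds
  remain for the density. The other half of \<open>\<epsilon>\<close> absorbs the \<open>+ 1\<close> in \<open>b + 1\<close>.\<close>

lemma edge_density_arithmetic:
  fixes \<epsilon> p :: real and n d b :: nat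
  assumes "0 < \<epsilon>" "\<epsilon> < 1" "12 \<le> \<epsilon> * d" "6 \<le> \<epsilon> * n" "real b \<le> (1 - \<epsilon>) * n / 2"
  defines "p \<equiv> 2 / ((1 - \<epsilon> / 2) * n)"
  shows "0 \<le> p" "p \<le> 4 / n" "p * (real b + 1) \<le> 1" "(real d + 3) * n \<le> real d * (p * (n choose 2))"
proof -
  have n: "0 < real n" using assms by (cases "n = 0") auto
  have d: "0 < real d" using assms by (cases "d = 0") auto
  have e: "1 / 2 \<le> 1 - \<epsilon> / 2" using assms by simp
  show "0 \<le> p" using e n by (simp add: p_def)
  have "(1 / 2) * real n \<le> (1 - \<epsilon> / 2) * n" using e n by (intro mult_right_mono) auto
  then have "p \<le> 2 / ((1 / 2) * real n)" unfolding p_def using n by (intro divide_left_mono) auto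
  then show "p \<le> 4 / n" by simp
  have pos: "0 < (1 - \<epsilon> / 2) * n" using e n by simp
  have "2 * (real b + 1) \<le> (1 - \<epsilon> / 2) * n" using assms by (simp add: field_simps)
  then show "p * (real b + 1) \<le> 1" unfolding p_def using pos by (simp add: divide_simps)
  have choose: "real (n choose 2) = real n * (real n - 1) / 2"
    using n by (simp add: choose_two of_nat_diff real_of_nat_div)
  then have pN: "p * (n choose 2) = (real n - 1) / (1 - \<epsilon> / 2)"
    unfolding p_def choose using n e by (simp add: field_simps)
  have n6: "6 \<le> n"
  proof -
    have "\<epsilon> * real n \<le> 1 * real n" using assms n by (intro mult_right_mono) auto
    then show ?thesis using assms by linarith
  qed
  have "(1 + \<epsilon> / 2) * (1 - \<epsilon> / 2) \<le> 1" by (simp add: algebra_simps)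
  then have "(1 + \<epsilon> / 2) * (1 - \<epsilon> / 2) * (real n - 1) \<le> 1 * (real n - 1)"
    using n6 by (intro mult_right_mono) auto
  then have "(1 + \<epsilon> / 2) * (real n - 1) \<le> p * (n choose 2)"
    unfolding pN using e by (simp add: field_simps)
  moreover have "(1 + \<epsilon> / 4) * n \<le> (1 + \<epsilon> / 2) * (real n - 1)"
    using assms by (simp add: field_simps)
  ultimately have "real d * ((1 + \<epsilon> / 4) * n) \<le> real d * (p * (n choose 2))"
    using d by (intro mult_left_mono) auto
  moreover have "(real d + 3) * n \<le> (real d * (1 + \<epsilon> / 4)) * n"
    using assms by (intro mult_right_mono) (auto simp: field_simps)
  ultimately show "(real d + 3) * n \<le> real d * (p * (n choose 2))" by (simp add: mult.assoc)
qed

theorem theorem7: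
  "\<forall>\<epsilon>::real. 0 < \<epsilon> \<and> \<epsilon> < 1 \<longrightarrow>
     (\<exists>c::real. 0 < c \<and>
       (\<exists>n0::nat. \<forall>n::nat. n0 < n \<longrightarrow>
         (\<forall>b::nat. 1 \<le> b \<and> real b \<le> (1 - \<epsilon>) * real n / 2 \<longrightarrow>
           client_can_force (complete_graph_edges n) b
             (\<lambda>E. \<exists>vs. is_cycle E vs \<and> c * real n \<le> real (length vs)))))"
proof (intro allI impI)
  fix \<epsilon> :: real
  assume \<epsilon>: "0 < \<epsilon> \<and> \<epsilon> < 1"
  define d where "d = nat \<lceil>12 / \<epsilon>\<rceil>"
  have "12 / \<epsilon> \<le> real d" unfolding d_def by linarith
  then have \<epsilon>d: "12 \<le> \<epsilon> * d" using \<epsilon> by (simp add: field_simps)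
  then have d: "1 \<le> d" by (cases "d = 0") auto
  define M :: real where "M = (4 * exp 1) ^ (2 * d + 1)"
  have "real d \<le> 2 ^ d" by (simp add: less_imp_le)
  also have "\<dots> \<le> (4 * exp 1) ^ d"
    using exp_ge_add_one_self[of 1] by (intro power_mono) auto
  also have "\<dots> \<le> M"
    unfolding M_def using exp_ge_add_one_self[of 1] by (intro power_increasing) auto
  finally have M: "real d \<le> M" .
  then have M0: "0 < M" using d by linarith
  define n0 where "n0 = nat \<lceil>6 / \<epsilon> + M * (8 * (d + 1))\<rceil>"
  define c where "c = 1 / (4 * M * (d + 1))"
  have "client_can_force (complete_graph_edges n) b
             (\<lambda>E. \<exists>vs. is_cycle E vs \<and> c * real n \<le> real (length vs))"
    if n: "n0 < n" and b: "real b \<le> (1 - \<epsilon>) * real n / 2" for n b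
  proof -
    have large: "6 / \<epsilon> + M * (8 * (d + 1)) \<le> real n"
      using n unfolding n0_def by linarith
    have "0 \<le> M * (8 * (d + 1))" "0 \<le> 6 / \<epsilon>" using M0 \<epsilon> by auto
    then have n_large: "6 / \<epsilon> \<le> real n" "M * (8 * (d + 1)) \<le> real n" using large by linarith+
    then have \<epsilon>n: "6 \<le> \<epsilon> * n" using \<epsilon> by (simp add: field_simps)
    define B where "B = nat \<lfloor>n / M\<rfloor>"
    have "0 \<le> n / M" using M0 by simp
    then have B: "real B \<le> n / M" "n / M < real B + 1" unfolding B_def by linarith+
    have MB: "M * real B \<le> real n" using B(1) M0 by (simp add: field_simps)
    have "real (8 * (d + 1)) \<le> n / M" using n_large(2) M0 by (simp add: field_simps)
    then have "real (8 * (d + 1)) < real (B + 1)" using B(2) by simp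
    then have "8 * (d + 1) \<le> B" by linarith
    then have B4: "2 * (d + 1) \<le> B div 4" by linarith
    define p where "p = 2 / ((1 - \<epsilon> / 2) * n)"
    note arith = edge_density_arithmetic[OF _ _ \<epsilon>d \<epsilon>n b, folded p_def]
    have p: "0 \<le> p" "p \<le> 4 / n" "p * (real b + 1) \<le> 1" "(real d + 3) * n \<le> real d * (p * (n choose 2))"
      using arith \<epsilon> by blast+
    have "client_can_force (complete_graph_edges n) b (\<lambda>D. \<exists>E\<subseteq>D. E \<subseteq> pairs {..<n} \<and>
           p * (n choose 2) - B \<le> real (card E) \<and> (\<forall>A\<in>crowded d B {..<n}. \<not> A \<subseteq> E))"
      using d p MB by (intro client_forces_locally_sparse) (auto simp: M_def)
    then show ?thesis
    proof (rule client_can_force_mono)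
      fix D assume "\<exists>E\<subseteq>D. E \<subseteq> pairs {..<n} \<and>
           p * (n choose 2) - B \<le> real (card E) \<and> (\<forall>A\<in>crowded d B {..<n}. \<not> A \<subseteq> E)"
      then obtain E where E: "E \<subseteq> D" "E \<subseteq> pairs {..<n}" "p * (n choose 2) - B \<le> real (card E)"
        "\<forall>A\<in>crowded d B {..<n}. \<not> A \<subseteq> E" by (elim exE conjE)
      have "real d * real B \<le> M * real B" using M by (intro mult_right_mono) auto
      then have dB: "real d * real B \<le> n" using MB by linarith
      have "real d * (p * (n choose 2) - B) \<le> real d * real (card E)"
        using E(3) by (intro mult_left_mono) auto
      then have "(real d + 2) * n \<le> real d * real (card E)"
        using p(4) dB by (simp add: algebra_simps)
      then have "real ((d + 2) * card {..<n}) \<le> real (d * card E)" by (simp add: algebra_simps)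
      then have dense: "(d + 2) * card {..<n} \<le> d * card E" by (simp only: of_nat_le_iff)
      have "{..<n} \<noteq> {}" using n by auto
      obtain vs where vs: "is_cycle E vs" "B div 4 < (d + 1) * length vs"
      proof (rule long_cycle_of_locally_sparse)
        show "e \<subseteq> {..<n} \<and> card e = 2" if "e \<in> E" for e
          using that E(2) by (auto simp: pairs_def)
        show "d * card (edges_in E S) \<le> (d + 1) * card S"
          if "S \<subseteq> {..<n}" "S \<noteq> {}" "card S \<le> B" for S
          using sparse_of_no_crowded[OF _ E(2) E(4)[rule_format] that] by simp
      qed (use dense B4 \<open>{..<n} \<noteq> {}\<close> in auto)
      have "B + 1 \<le> 4 * ((d + 1) * length vs)" using vs(2) by linarith
      then have "real (B + 1) \<le> real (4 * ((d + 1) * length vs))" by (simp only: of_nat_le_iff)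
      then have "n / M \<le> 4 * (real d + 1) * length vs" using B(2) by (simp add: algebra_simps)
      then have "n / M / (4 * (real d + 1)) \<le> length vs"
        by (subst pos_divide_le_eq) (auto simp: algebra_simps)
      then have "c * n \<le> length vs" by (simp add: c_def algebra_simps)
      moreover have "is_cycle D vs" using vs(1) E(1) by (auto simp: is_cycle_def)
      ultimately show "\<exists>vs. is_cycle D vs \<and> c * real n \<le> real (length vs)" by blast
    qed
  qed
  moreover have "0 < c" using M0 by (simp add: c_def)
  ultimately show "\<exists>c::real. 0 < c \<and>
       (\<exists>n0::nat. \<forall>n::nat. n0 < n \<longrightarrow>
         (\<forall>b::nat. 1 \<le> b \<and> real b \<le> (1 - \<epsilon>) * real n / 2 \<longrightarrow>
           client_can_force (complete_graph_edges n) b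
             (\<lambda>E. \<exists>vs. is_cycle E vs \<and> c * real n \<le> real (length vs))))"
    by blast
qed

end
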